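(* Let $r\in\mathbb{N}$, $\mathbf{m}=(m_1,\dots,m_r)\in\mathbb{N}^r$, $m=m_1+\cdots+m_r$, $\mathbf{f}\in\mathbb{C}^r$, $a,b,c,d,e,g\in\mathbb{C}$, $n\in\mathbb{N}$, and put $\lambda=c-a-b-m$. Suppose $g+e+n+\lambda-d=2$, $(1+a+b-c)_m\ne0$, $(c-a-m)_m\ne0$ and $(c-b-m)_m\ne0$. Then $$ F\left(\begin{matrix}-n,a,b,d,\mathbf{f}+\mathbf{m}\\c,g,e,\mathbf{f}\end{matrix}\right) =B\cdot F\left(\begin{matrix}-n,\;a+\lambda,\;b+\lambda,\;d,\;\nu+1,\;\hat{\boldsymbol\zeta}+1\\c,\;g+\lambda,\;e+\lambda,\;\nu,\;\hat{\boldsymbol\zeta}\end{matrix}\right), $$ where $$ B=\frac{(g+\lambda)_{n-1}(e+\lambda)_{n-1}}{(g)_{n}(e)_{n}}\bigl(nd+(g+\lambda-1)(e+\lambda-1)\bigr),\qquad \nu=\frac{nd+(g+\lambda-1)(e+\lambda-1)}{g+e+n-d+2(\lambda-1)}, $$ and $\hat{\boldsymbol\zeta}=(\zeta_1,\dots,\zeta_m)$ is the vector of zeros of the polynomial $\hat{Q}_m(a,b,c,\mathbf{f},\mathbf{m};t)$ (defined in the context).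
   Context: Notation: $(a)_n=\Gamma(a+n)/\Gamma(a)$; for vectors $(\mathbf{a})_n=\prod_j(a_j)_n$, and $\mathbf{a}+\beta$ means adding $\beta$ to each component. $F\left(\begin{smallmatrix}\mathbf{a}\\\mathbf{b}\end{smallmatrix}\right)=\sum_{k\ge0}\frac{(\mathbf{a})_k}{(\mathbf{b})_k k!}$ is the generalized hypergeometric series at unit argument. Standing convention: lower parameters are never non-positive integers, and denominators occurring in the formulas do not vanish. $$ \hat{Q}_m(a,b,c,\mathbf{f},\mathbf{m};t)=\sum_{k=0}^{m}\frac{{}_{r+1}F_{r}(-k,\mathbf{f}+\mathbf{m};\mathbf{f}\,|\,1)\,(a)_k(b)_k(t)_k}{(c-a-m)_k(c-b-m)_k\,k!}\;{}_{3}F_{2}\left(\begin{matrix}-m+k,\;t+k,\;c-a-b-m\\c-a-m+k,\;c-b-m+k\end{matrix}\,\Big|\,1\right). $$ Zeros are listed with multiplicity; as implicit in the notation $(\zeta_1,\dots,\zeta_m)$, $\hat{Q}_m$ is taken to have exact degree $m$. *)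

theory Defs
  imports "HOL-Analysis.Analysis" "HOL-Computational_Algebra.Computational_Algebra"
begin

definition hypF :: "complex list \<Rightarrow> complex list \<Rightarrow> complex" where
  "hypF as bs = (\<Sum>k. (\<Prod>x\<leftarrow>as. pochhammer x k) / ((\<Prod>y\<leftarrow>bs. pochhammer y k) * fact k))"

lemma hypF_eq_eval_fps_hypergeo: "hypF as bs = eval_fps (fps_hypergeo as bs 1) 1"
proof -
  have "foldl (\<lambda>r x. r * pochhammer x k) v xs = v * (\<Prod>x\<leftarrow>xs. pochhammer x k)"
    for k and v :: complex and xs
    by (induction xs arbitrary: v) (auto simp: mult_ac)
  then show ?thesis
    by (simp add: hypF_def eval_fps_def)
qed

definition shift_params :: "complex list \<Rightarrow> nat list \<Rightarrow> complex list" where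
  "shift_params fs ms = map2 (\<lambda>x k. x + of_nat k) fs ms"

text \<open>The library's \<open>pochhammer\<close> has a natural-number index. The index \<open>n - 1\<close> is
  \<open>-1\<close> when \<open>n = 0\<close>, where only the quotient of Gamma values makes sense.\<close>

definition poch_int :: "complex \<Rightarrow> int \<Rightarrow> complex" where
  "poch_int z k = Gamma (z + of_int k) / Gamma z"

lemma poch_int_of_nat: "z \<notin> \<int>\<^sub>\<le>\<^sub>0 \<Longrightarrow> poch_int z (int k) = pochhammer z k"
  by (simp add: poch_int_def pochhammer_Gamma)

definition Qhat :: "complex \<Rightarrow> complex \<Rightarrow> complex \<Rightarrow> complex list \<Rightarrow> nat list \<Rightarrow> complex \<Rightarrow> complex" where
  "Qhat a b c fs ms t =
     (let m = sum_list ms in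
      \<Sum>k\<le>m. hypF (- of_nat k # shift_params fs ms) fs *
        pochhammer a k * pochhammer b k * pochhammer t k /
        (pochhammer (c - a - of_nat m) k * pochhammer (c - b - of_nat m) k * fact k) *
        hypF [- of_nat m + of_nat k, t + of_nat k, c - a - b - of_nat m]
             [c - a - of_nat m + of_nat k, c - b - of_nat m + of_nat k])"

lemma hypF_terminating:
  "hypF (- of_nat n # as) bs =
     (\<Sum>k\<le>n. (\<Prod>x\<leftarrow>- of_nat n # as. pochhammer x k) / ((\<Prod>y\<leftarrow>bs. pochhammer y k) * fact k))"
  unfolding hypF_def
  by (rule suminf_finite) (auto simp: pochhammer_of_nat_eq_0_iff)

lemma Qhat_polynomial: "\<exists>!Q. \<forall>t. poly Q t = Qhat a b c fs ms t"
proof (rule ex_ex1I)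
  define m where "m = sum_list ms"
  have poch: "poly (pochhammer [:s, 1:] j) t = pochhammer (t + s) j" for s t :: complex and j
    by (induction j) (simp_all add: pochhammer_Suc algebra_simps of_nat_poly)
  have "\<exists>P. \<forall>t. poly P t =
      hypF [- of_nat m + of_nat k, t + of_nat k, c - a - b - of_nat m]
        [c - a - of_nat m + of_nat k, c - b - of_nat m + of_nat k]" if "k \<le> m" for k
  proof -
    have neg: "- of_nat m + of_nat k = - (of_nat (m - k) :: complex)"
      using that by (simp add: of_nat_diff)
    show ?thesis
      unfolding neg hypF_terminating
      by (rule exI[of _ "\<Sum>j\<le>m - k. smult (pochhammer (- of_nat (m - k)) j *
            pochhammer (c - a - b - of_nat m) j /
            (pochhammer (c - a - of_nat m + of_nat k) j *
             pochhammer (c - b - of_nat m + of_nat k) j * fact j))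
            (pochhammer [:of_nat k, 1:] j)"])
         (auto simp: poly_sum poch mult_ac intro!: sum.cong)
  qed
  then obtain P where P: "\<And>k t. k \<le> m \<Longrightarrow> poly (P k) t =
      hypF [- of_nat m + of_nat k, t + of_nat k, c - a - b - of_nat m]
        [c - a - of_nat m + of_nat k, c - b - of_nat m + of_nat k]"
    by metis
  show "\<exists>Q. \<forall>t. poly Q t = Qhat a b c fs ms t"
    by (rule exI[of _ "\<Sum>k\<le>m. smult (hypF (- of_nat k # shift_params fs ms) fs *
            pochhammer a k * pochhammer b k /
            (pochhammer (c - a - of_nat m) k * pochhammer (c - b - of_nat m) k * fact k))
            (pochhammer [:0, 1:] k * P k)"])
       (auto simp: Qhat_def Let_def m_def[symmetric] poly_sum P poch mult_ac intro!: sum.cong)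
next
  show "Q = R" if "\<forall>t. poly Q t = Qhat a b c fs ms t" "\<forall>t. poly R t = Qhat a b c fs ms t" for Q R
    using that by (metis poly_eq_poly_eq_iff ext)
qed

end

theory Submission
  imports Defs
begin

text \<open>
  By the second Miller--Paris transformation, \<open>F(a, b, f+m; c, f | x)\<close> equals
  \<open>(1-x)\<^sup>\<lambda>\<close> times \<open>F(a+\<lambda>, b+\<lambda>, \<zeta>+1; c, \<zeta> | x)\<close>. Its coefficientwise form comes from expanding
  the polynomial \<open>k \<mapsto> (f+m)\<^sub>k / (f)\<^sub>k\<close> in its Newton series, whose coefficients are the
  \<open>F(-l, f+m; f)\<close> in the definition of \<open>Qhat\<close>, and applying to each term a terminating 3F2
  transformation, itself a double application of the Chu--Vandermonde identity.

  Weighting the coefficient of \<open>x\<^sup>k\<close> by \<open>(-n)\<^sub>k (d)\<^sub>k / ((g)\<^sub>k (e)\<^sub>k)\<close> gives the left-hand side. On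
  the right-hand side each Taylor coefficient of the second factor is multiplied by a terminating
  3F2 of parametric excess 2. This has a closed form, Saalschuetz's product times a linear factor,
  which is where \<open>\<nu>\<close> comes from.
\<close>

section \<open>Triangular sums and the Chu-Vandermonde identity\<close>

lemma sum_triangle_swap:
  fixes g :: "nat \<Rightarrow> nat \<Rightarrow> 'a::comm_monoid_add"
  shows "(\<Sum>i\<le>n. \<Sum>k\<le>n-i. g i k) = (\<Sum>k\<le>n. \<Sum>i\<le>n-k. g i k)"
  unfolding sum.Sigma[OF finite_atMost ballI, OF finite_atMost]
  by (rule sum.reindex_bij_witness[of _ "\<lambda>(k,i). (i,k)" "\<lambda>(k,i). (i,k)"]) auto

lemma sum_triangle_diagonal:
  fixes g :: "nat \<Rightarrow> nat \<Rightarrow> 'a::comm_monoid_add"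
  shows "(\<Sum>i\<le>n. \<Sum>k\<le>n-i. g i (i + k)) = (\<Sum>p\<le>n. \<Sum>i\<le>p. g i p)"
  unfolding sum.Sigma[OF finite_atMost ballI, OF finite_atMost]
  by (rule sum.reindex_bij_witness[of _ "\<lambda>(p,i). (i,p-i)" "\<lambda>(i,k). (i+k,i)"]) auto

lemma pochhammer_reflect:
  fixes x :: "'a::comm_ring_1"
  shows "pochhammer x n = (-1) ^ n * pochhammer (1 - x - of_nat n) n"
  using pochhammer_minus[of "-x" n] by (simp add: algebra_simps)

text \<open>Chu-Vandermonde for \<open>2F1(-n, y; x; 1)\<close> with denominators cleared:
  reflecting turns \<open>x - y\<close> into the sum \<open>y + (1 - x - n)\<close>, and after
  expanding, each factor in \<open>1 - x - n\<close> is reflected back.\<close>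

lemma pochhammer_shift_sum:
  fixes x y :: "'a::comm_ring_1"
  shows "pochhammer (x - y) n =
    (\<Sum>i\<le>n. of_nat (n choose i) * (-1) ^ i * pochhammer y i * pochhammer (x + of_nat i) (n - i))"
proof -
  have "pochhammer (x - y) n = (-1) ^ n * pochhammer (y + (1 - x - of_nat n)) n"
    by (subst pochhammer_reflect) (simp add: algebra_simps)
  also have "\<dots> = (\<Sum>i\<le>n. (-1) ^ n * (of_nat (n choose i) * pochhammer y i *
      pochhammer (1 - x - of_nat n) (n - i)))"
    by (simp add: pochhammer_binomial_sum sum_distrib_left)
  also have "\<dots> = (\<Sum>i\<le>n. of_nat (n choose i) * (-1) ^ i * pochhammer y i * pochhammer (x + of_nat i) (n - i))"
  proof (rule sum.cong[OF refl])
    fix i assume "i \<in> {..n}"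
    then have i: "i \<le> n" by simp
    then have "(-1) ^ n = (-1 :: 'a) ^ i * (-1) ^ (n - i)"
      by (simp flip: power_add)
    moreover have "pochhammer (x + of_nat i) (n - i) = (-1) ^ (n - i) * pochhammer (1 - x - of_nat n) (n - i)"
      using i by (subst pochhammer_reflect) (simp add: of_nat_diff algebra_simps)
    ultimately show "(-1) ^ n * (of_nat (n choose i) * pochhammer y i * pochhammer (1 - x - of_nat n) (n - i)) =
      of_nat (n choose i) * (-1) ^ i * pochhammer y i * pochhammer (x + of_nat i) (n - i)"
      by (simp add: algebra_simps)
  qed
  finally show ?thesis .
qed

section \<open>Terminating 3F2 series at unit argument\<close>

text \<open>Chu-Vandermonde is used twice. Splitting \<open>ga + i\<close> as
  \<open>(ga - B) + (B + i)\<close> lets \<open>(B)_i\<close> merge into \<open>(B)_(n-k)\<close>,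
  which is free of \<open>i\<close>; after the swap, the sum over \<open>i\<close> expands
  \<open>(A + la + k)_(n-k)\<close>. Writing \<open>(x + i)_(n-i)\<close> for the quotient
  \<open>(x)_n / (x)_i\<close> keeps everything valid in any commutative ring.\<close>

lemma convolution_3F2_eq_common_sum:
  fixes A B ga la :: "'a::comm_ring_1"
  shows "(\<Sum>i\<le>n. of_nat (n choose i) * pochhammer la (n - i) * pochhammer A i * pochhammer B i *
            pochhammer (ga + of_nat i) (n - i)) =
         (\<Sum>k\<le>n. of_nat (n choose k) * pochhammer (ga - B) k * pochhammer B (n - k) *
            pochhammer la k * pochhammer (A + la + of_nat k) (n - k))"
proof -
  have "(\<Sum>i\<le>n. of_nat (n choose i) * pochhammer la (n - i) * pochhammer A i * pochhammer B i *
            pochhammer (ga + of_nat i) (n - i)) =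
    (\<Sum>i\<le>n. \<Sum>k\<le>n-i. of_nat ((n choose i) * ((n - i) choose k)) * pochhammer la (n - i) *
      pochhammer A i * pochhammer (ga - B) k * pochhammer B (n - k))"
  proof (rule sum.cong[OF refl])
    fix i assume "i \<in> {..n}"
    then have i: "i \<le> n" by simp
    have "pochhammer (ga + of_nat i) (n - i) = pochhammer ((ga - B) + (B + of_nat i)) (n - i)"
      by simp
    also have "\<dots> = (\<Sum>k\<le>n-i. of_nat ((n-i) choose k) * pochhammer (ga - B) k * pochhammer (B + of_nat i) (n - i - k))"
      by (rule pochhammer_binomial_sum)
    finally have 1: "pochhammer (ga + of_nat i) (n - i) = \<dots>" .
    have 2: "pochhammer B (n - k) = pochhammer B i * pochhammer (B + of_nat i) (n - i - k)" if "k \<le> n - i" for k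
      using pochhammer_product[of i "n - k" B] that i by (simp add: add.commute)
    show "of_nat (n choose i) * pochhammer la (n - i) * pochhammer A i * pochhammer B i *
            pochhammer (ga + of_nat i) (n - i) =
      (\<Sum>k\<le>n-i. of_nat ((n choose i) * ((n - i) choose k)) * pochhammer la (n - i) *
      pochhammer A i * pochhammer (ga - B) k * pochhammer B (n - k))"
      unfolding 1 sum_distrib_left by (intro sum.cong refl) (simp add: 2 mult_ac)
  qed
  also have "\<dots> = (\<Sum>k\<le>n. \<Sum>i\<le>n-k. of_nat ((n choose i) * ((n - i) choose k)) * pochhammer la (n - i) *
      pochhammer A i * pochhammer (ga - B) k * pochhammer B (n - k))"
    by (rule sum_triangle_swap)
  also have "\<dots> = (\<Sum>k\<le>n. of_nat (n choose k) * pochhammer (ga - B) k * pochhammer B (n - k) *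
            pochhammer la k * pochhammer (A + la + of_nat k) (n - k))"
  proof (rule sum.cong[OF refl])
    fix k assume "k \<in> {..n}"
    then have k: "k \<le> n" by simp
    have 1: "(n choose i) * ((n - i) choose k) = (n choose k) * ((n - k) choose i)" if "i \<le> n - k" for i
      using choose_mult[of k "n - i" n] that k binomial_symmetric[of i n] binomial_symmetric[of i "n - k"]
      by (simp add: add.commute)
    have 2: "pochhammer la (n - i) = pochhammer la k * pochhammer (la + of_nat k) (n - k - i)" if "i \<le> n - k" for i
      using pochhammer_product[of k "n - i" la] that k by (simp add: add.commute)
    have 3: "pochhammer (A + la + of_nat k) (n - k) =
      (\<Sum>i\<le>n-k. of_nat ((n-k) choose i) * pochhammer A i * pochhammer (la + of_nat k) (n - k - i))"
      using pochhammer_binomial_sum[of A "la + of_nat k" "n - k"] by (simp add: add.assoc)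
    show "(\<Sum>i\<le>n-k. of_nat ((n choose i) * ((n - i) choose k)) * pochhammer la (n - i) *
      pochhammer A i * pochhammer (ga - B) k * pochhammer B (n - k)) =
      of_nat (n choose k) * pochhammer (ga - B) k * pochhammer B (n - k) *
            pochhammer la k * pochhammer (A + la + of_nat k) (n - k)"
      unfolding 3 sum_distrib_left by (intro sum.cong refl) (simp add: 1 2 mult_ac)
  qed
  finally show ?thesis .
qed

text \<open>Here \<open>B + la + i\<close> is split as \<open>(la + i) + B\<close>, so that
  \<open>(la)_i\<close> merges into \<open>(la)_p\<close> with \<open>p = i + k\<close>. For fixed
  \<open>p\<close>, the sum over \<open>i\<close> is the alternating Chu-Vandermonde sum
  \<open>pochhammer_shift_sum\<close> for \<open>A + la - mu\<close>.\<close>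

lemma alternating_3F2_eq_common_sum:
  fixes A B la mu :: "'a::comm_ring_1"
  shows "(\<Sum>i\<le>n. of_nat (n choose i) * (-1) ^ i * pochhammer mu i * pochhammer la i *
            pochhammer (A + la + of_nat i) (n - i) * pochhammer (B + la + of_nat i) (n - i)) =
         (\<Sum>k\<le>n. of_nat (n choose k) * pochhammer (A + la - mu) k * pochhammer B (n - k) *
            pochhammer la k * pochhammer (A + la + of_nat k) (n - k))"
proof -
  \<comment> \<open>The index \<open>i + k - i\<close> stays unsimplified: the summand must be a
    function of \<open>i\<close> and \<open>i + k\<close> to match
    \<open>sum_triangle_diagonal\<close>.\<close>
  have "(\<Sum>i\<le>n. of_nat (n choose i) * (-1) ^ i * pochhammer mu i * pochhammer la i *
            pochhammer (A + la + of_nat i) (n - i) * pochhammer (B + la + of_nat i) (n - i)) =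
    (\<Sum>i\<le>n. \<Sum>k\<le>n-i. of_nat ((n choose i) * ((n - i) choose (i + k - i))) * (-1) ^ i * pochhammer mu i *
       pochhammer la (i + k) * pochhammer B (n - (i + k)) * pochhammer (A + la + of_nat i) (n - i))"
  proof (rule sum.cong[OF refl])
    fix i assume "i \<in> {..n}"
    then have i: "i \<le> n" by simp
    have "pochhammer (B + la + of_nat i) (n - i) =
      (\<Sum>k\<le>n-i. of_nat ((n-i) choose k) * pochhammer (la + of_nat i) k * pochhammer B (n - i - k))"
      using pochhammer_binomial_sum[of "la + of_nat i" B "n - i"] by (simp add: algebra_simps)
    then show "of_nat (n choose i) * (-1) ^ i * pochhammer mu i * pochhammer la i *
            pochhammer (A + la + of_nat i) (n - i) * pochhammer (B + la + of_nat i) (n - i) =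
     (\<Sum>k\<le>n-i. of_nat ((n choose i) * ((n - i) choose (i + k - i))) * (-1) ^ i * pochhammer mu i *
       pochhammer la (i + k) * pochhammer B (n - (i + k)) * pochhammer (A + la + of_nat i) (n - i))"
      by (simp add: sum_distrib_left pochhammer_product' mult_ac)
  qed
  also have "\<dots> = (\<Sum>p\<le>n. \<Sum>i\<le>p. of_nat ((n choose i) * ((n - i) choose (p - i))) * (-1) ^ i * pochhammer mu i *
       pochhammer la p * pochhammer B (n - p) * pochhammer (A + la + of_nat i) (n - i))"
    by (rule sum_triangle_diagonal)
  also have "\<dots> = (\<Sum>k\<le>n. of_nat (n choose k) * pochhammer (A + la - mu) k * pochhammer B (n - k) *
            pochhammer la k * pochhammer (A + la + of_nat k) (n - k))"
  proof (rule sum.cong[OF refl])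
    fix p assume "p \<in> {..n}"
    then have p: "p \<le> n" by simp
    have choose: "(n choose i) * ((n - i) choose (p - i)) = (n choose p) * (p choose i)" if "i \<le> p" for i
      using choose_mult[of i p n] that p by simp
    have 2: "pochhammer (A + la + of_nat i) (n - i) =
       pochhammer (A + la + of_nat i) (p - i) * pochhammer (A + la + of_nat p) (n - p)" if "i \<le> p" for i
    proof -
      have "A + la + of_nat i + of_nat (p - i) = A + la + of_nat p"
        using that by (simp add: of_nat_diff)
      moreover have "n - i - (p - i) = n - p" "p - i \<le> n - i" using that p by auto
      ultimately show ?thesis
        using pochhammer_product[of "p - i" "n - i" "A + la + of_nat i"] by (simp only:)
    qed
    show "(\<Sum>i\<le>p. of_nat ((n choose i) * ((n - i) choose (p - i))) * (-1) ^ i * pochhammer mu i *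
       pochhammer la p * pochhammer B (n - p) * pochhammer (A + la + of_nat i) (n - i)) =
      of_nat (n choose p) * pochhammer (A + la - mu) p * pochhammer B (n - p) *
            pochhammer la p * pochhammer (A + la + of_nat p) (n - p)"
      unfolding pochhammer_shift_sum sum_distrib_left sum_distrib_right
    proof (intro sum.cong refl, goal_cases)
      case (1 i)
      then have i: "i \<le> p" by simp
      show ?case unfolding 2[OF i] choose[OF i] of_nat_mult by (simp only: mult_ac)
    qed
  qed
  finally show ?thesis .
qed

lemma terminating_3F2_transformation:
  fixes A B ga la mu :: "'a::comm_ring_1"
  assumes "mu = A + B + la - ga"
  shows "(\<Sum>i\<le>n. of_nat (n choose i) * pochhammer la (n - i) * pochhammer A i * pochhammer B i *
            pochhammer (ga + of_nat i) (n - i)) =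
         (\<Sum>i\<le>n. of_nat (n choose i) * (-1) ^ i * pochhammer mu i * pochhammer la i *
            pochhammer (A + la + of_nat i) (n - i) * pochhammer (B + la + of_nat i) (n - i))"
proof -
  have "A + la - mu = ga - B" using assms by simp
  then show ?thesis
    using convolution_3F2_eq_common_sum[of n la A B ga] alternating_3F2_eq_common_sum[of n mu la A B] by simp
qed

text \<open>With \<open>la := D\<close> and \<open>B := E - D\<close>, the common sum contains
  \<open>(E - D)_(n+1-k)\<close>, which the balance condition lets one reflect so that it nearly
  continues \<open>(G - A)_k\<close>. What remains is \<open>h - 1 + k\<close> times a
  Chu-Vandermonde summand \<open>t k\<close>, so only the sum and the first moment of
  \<open>t\<close> are needed.\<close>

lemma near_Saalschutz_sum:
  fixes A D E G :: "'a::comm_ring_1"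
  assumes "G + E + of_nat (Suc n) = 2 + A + D"
  shows "(\<Sum>i\<le>Suc n. of_nat (Suc n choose i) * (-1) ^ i * pochhammer A i * pochhammer D i *
            pochhammer (G + of_nat i) (Suc n - i) * pochhammer (E + of_nat i) (Suc n - i)) =
         pochhammer (G - A) n * pochhammer (E - A) n * (of_nat (Suc n) * D + (G - A - 1) * (E - A - 1))"
    (is "?lhs = _")
proof -
  define h where "h = G - A"
  define t where "t = (\<lambda>i. of_nat (Suc n choose i) * (-1) ^ i * pochhammer D i * pochhammer (G + of_nat i) (Suc n - i))"
  \<comment> \<open>The ring identity closing the computation: \<open>x\<close> stands for
    \<open>(-1) ^ n\<close>, \<open>p\<close> for \<open>(h)_n\<close>, \<open>y\<close> for
    \<open>(E - A)_n\<close> and \<open>q\<close> for \<open>E - A - 1\<close>.\<close>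
  have aux: "- 1 * x * p * ((h - 1) * - (q * (x * y)) + - N * D * (x * y)) =
    (x * x) * (p * y * (N * D + (h - 1) * q))" for x p q y N :: 'a
    by (simp add: algebra_simps)
  have ED: "E - D = 1 - (h - 1) - of_nat (Suc n)"
    using assms by (simp add: h_def algebra_simps)
  \<comment> \<open>Parametric excess 2 leaves a factor linear in \<open>k\<close>; for excess 1 it would be constant.\<close>
  have h: "pochhammer h k * pochhammer (h - 1 + of_nat k) (Suc n - k) = pochhammer h n * (h - 1 + of_nat k)"
    if "k \<le> Suc n" for k
  proof (cases "k = Suc n")
    case False
    then have k: "k \<le> n" using that by simp
    then show ?thesis
      using pochhammer_product[of k n h] by (simp add: Suc_diff_le pochhammer_rec mult_ac)
  qed (simp add: pochhammer_Suc)
  have "?lhs = (\<Sum>k\<le>Suc n. of_nat (Suc n choose k) * pochhammer h k * pochhammer (E - D) (Suc n - k) *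
            pochhammer D k * pochhammer (G + of_nat k) (Suc n - k))"
    using alternating_3F2_eq_common_sum[of "Suc n" A D "G - D" "E - D"] by (simp add: h_def)
  also have "\<dots> = (\<Sum>k\<le>Suc n. (-1) ^ Suc n * pochhammer h n * ((h - 1 + of_nat k) * t k))"
  proof (rule sum.cong[OF refl])
    fix k assume "k \<in> {..Suc n}"
    then have k: "k \<le> Suc n" by simp
    have "pochhammer (E - D) (Suc n - k) = (-1) ^ (Suc n - k) * pochhammer (h - 1 + of_nat k) (Suc n - k)"
      by (subst pochhammer_reflect) (use k in \<open>simp add: ED of_nat_diff algebra_simps\<close>)
    moreover have "(-1 :: 'a) ^ (Suc n - k) = (-1) ^ Suc n * (-1) ^ k"
      using k by (simp add: minus_one_power_iff)
    ultimately have "of_nat (Suc n choose k) * pochhammer h k * pochhammer (E - D) (Suc n - k) *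
            pochhammer D k * pochhammer (G + of_nat k) (Suc n - k) =
       (-1) ^ Suc n * (pochhammer h k * pochhammer (h - 1 + of_nat k) (Suc n - k)) * t k"
      by (simp only: t_def mult_ac)
    then show "of_nat (Suc n choose k) * pochhammer h k * pochhammer (E - D) (Suc n - k) *
            pochhammer D k * pochhammer (G + of_nat k) (Suc n - k) =
        (-1) ^ Suc n * pochhammer h n * ((h - 1 + of_nat k) * t k)"
      by (simp only: h[OF k] mult_ac)
  qed
  also have "\<dots> = (-1) ^ Suc n * pochhammer h n * ((h - 1) * (\<Sum>k\<le>Suc n. t k) + (\<Sum>k\<le>Suc n. of_nat k * t k))"
    by (simp only: sum_distrib_left[symmetric] sum.distrib distrib_right)
  also have "(\<Sum>k\<le>Suc n. t k) = pochhammer (G - D) (Suc n)"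
    unfolding pochhammer_shift_sum t_def ..
  also have "(\<Sum>k\<le>Suc n. of_nat k * t k) = (\<Sum>k\<le>n. of_nat (Suc k) * t (Suc k))"
    by (subst sum.atMost_Suc_shift) simp
  \<comment> \<open>Absorbing the factor \<open>Suc k\<close> into the binomial coefficient raises
    both \<open>D\<close> and \<open>G\<close> by one. Their difference is unchanged, so the first
    moment is again a Chu-Vandermonde sum for \<open>G - D\<close>.\<close>
  also have "\<dots> = (\<Sum>k\<le>n. - of_nat (Suc n) * D * (of_nat (n choose k) * (-1) ^ k * pochhammer (D + 1) k *
      pochhammer (G + 1 + of_nat k) (n - k)))"
  proof (rule sum.cong[OF refl])
    fix k assume "k \<in> {..n}"
    have "of_nat (Suc k) * of_nat (Suc n choose Suc k) = (of_nat (Suc n) * of_nat (n choose k) :: 'a)"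
      by (metis Suc_times_binomial_eq mult.commute of_nat_mult)
    then have "of_nat (Suc k) * t (Suc k) = of_nat (Suc n) * of_nat (n choose k) *
      ((-1) ^ Suc k * pochhammer D (Suc k) * pochhammer (G + of_nat (Suc k)) (n - k))"
      by (simp only: t_def mult.assoc[symmetric] diff_Suc_Suc)
    then show "of_nat (Suc k) * t (Suc k) = - of_nat (Suc n) * D * (of_nat (n choose k) * (-1) ^ k * pochhammer (D + 1) k *
      pochhammer (G + 1 + of_nat k) (n - k))"
      by (simp only: pochhammer_rec add.assoc mult_ac of_nat_Suc power_Suc minus_mult_left[symmetric]
          minus_mult_right[symmetric] mult_1_left)
  qed
  also have "\<dots> = - of_nat (Suc n) * D * pochhammer (G - D) n"
    unfolding sum_distrib_left[symmetric] pochhammer_shift_sum[symmetric] by simp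
  also have "pochhammer (G - D) (Suc n) = - ((E - A - 1) * pochhammer (G - D) n)"
  proof -
    have "G - D + of_nat n = - (E - A - 1)" using assms by (simp add: algebra_simps)
    then show ?thesis by (simp only: pochhammer_Suc) (metis mult.commute mult_minus_left)
  qed
  also have "pochhammer (G - D) n = (-1) ^ n * pochhammer (E - A) n"
  proof -
    have "1 - (G - D) - of_nat n = E - A" using assms by (simp add: algebra_simps)
    then show ?thesis by (subst pochhammer_reflect) simp
  qed
  finally have "?lhs = ((-1) ^ n * (-1) ^ n) * (pochhammer h n * pochhammer (E - A) n *
      (of_nat (Suc n) * D + (h - 1) * (E - A - 1)))"
    unfolding power_Suc by (rule trans[OF _ aux])
  then show ?thesis
    by (simp add: h_def flip: power_mult_distrib)
qed

section \<open>Finite differences and Newton series\<close>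

text \<open>Such a sum is \<open>(1 - S) ^ n\<close> applied to \<open>f\<close> at 0, where
  \<open>S\<close> is the shift operator. Pascal's rule splits off one factor
  \<open>1 - S\<close>.\<close>

lemma alternating_binomial_sum_Suc:
  fixes f :: "nat \<Rightarrow> 'a::comm_ring_1"
  shows "(\<Sum>i\<le>Suc n. (-1) ^ i * of_nat (Suc n choose i) * f i) =
         (\<Sum>i\<le>n. (-1) ^ i * of_nat (n choose i) * (f i - f (Suc i)))"
proof -
  have "(\<Sum>i\<le>Suc n. (-1) ^ i * of_nat (Suc n choose i) * f i) =
        f 0 + (\<Sum>i\<le>n. (-1) ^ Suc i * of_nat (Suc n choose Suc i) * f (Suc i))"
    by (subst sum.atMost_Suc_shift) simp
  also have "\<dots> = (f 0 + (\<Sum>i\<le>n. (-1) ^ Suc i * of_nat (n choose Suc i) * f (Suc i)))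
      - (\<Sum>i\<le>n. (-1) ^ i * of_nat (n choose i) * f (Suc i))"
    by (simp add: algebra_simps sum.distrib sum_subtractf sum_negf)
  also have "f 0 + (\<Sum>i\<le>n. (-1) ^ Suc i * of_nat (n choose Suc i) * f (Suc i)) =
      (\<Sum>i\<le>Suc n. (-1) ^ i * of_nat (n choose i) * f i)"
    by (subst sum.atMost_Suc_shift) simp
  also have "\<dots> = (\<Sum>i\<le>n. (-1) ^ i * of_nat (n choose i) * f i)"
    by (simp add: binomial_eq_0)
  finally show ?thesis
    by (simp add: algebra_simps sum_subtractf)
qed

text \<open>In terms of the shift operator \<open>S\<close>, this expands
  \<open>S ^ n = (1 - (1 - S)) ^ n\<close> by the binomial theorem. The induction applies the
  hypothesis both to \<open>f\<close> and to its difference.\<close>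

lemma binomial_inversion_alternating:
  fixes f :: "nat \<Rightarrow> 'a::comm_ring_1"
  shows "f n = (\<Sum>l\<le>n. (-1) ^ l * of_nat (n choose l) * (\<Sum>i\<le>l. (-1) ^ i * of_nat (l choose i) * f i))"
proof (induction n arbitrary: f)
  case (Suc n)
  define H where "H = (\<lambda>l. \<Sum>i\<le>l. (-1) ^ i * of_nat (l choose i) * f i)"
  have H_Suc: "H (Suc l) = (\<Sum>i\<le>l. (-1) ^ i * of_nat (l choose i) * (f i - f (Suc i)))" for l
    unfolding H_def by (rule alternating_binomial_sum_Suc)
  have "f (Suc n) = f n - (f n - f (Suc n))" by simp
  also have "\<dots> = (\<Sum>l\<le>n. (-1) ^ l * of_nat (n choose l) * H l)
     - (\<Sum>l\<le>n. (-1) ^ l * of_nat (n choose l) * H (Suc l))"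
    unfolding H_Suc unfolding H_def by (intro arg_cong2[of _ _ _ _ "(-)"] Suc)
  also have "\<dots> = (\<Sum>l\<le>Suc n. (-1) ^ l * of_nat (Suc n choose l) * H l)"
    unfolding alternating_binomial_sum_Suc by (simp add: sum_subtractf right_diff_distrib)
  finally show ?case
    unfolding H_def .
qed simp

text \<open>Composition with \<open>x + 1\<close> preserves the leading coefficient, so each
  difference of a nonconstant polynomial lowers the degree, and a constant has difference 0.\<close>

lemma alternating_binomial_sum_poly_eq_0:
  fixes p :: "'a::idom poly"
  assumes "degree p < n"
  shows "(\<Sum>i\<le>n. (-1) ^ i * of_nat (n choose i) * poly p (of_nat i)) = 0"
  using assms
proof (induction n arbitrary: p)
  case (Suc n)
  let ?q = "p - pcompose p [:1, 1:]"
  have shift: "poly ?q (of_nat i) = poly p (of_nat i) - poly p (of_nat (Suc i))" for i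
    by (simp add: poly_pcompose add.commute)
  show ?case
  proof (cases "degree p = 0")
    case True
    then obtain s where "p = [:s:]" by (rule degree_eq_zeroE)
    then show ?thesis unfolding alternating_binomial_sum_Suc by simp
  next
    case False
    have "degree ?q \<le> degree p"
      by (rule degree_diff_le) (simp_all add: degree_pcompose)
    moreover have "coeff ?q (degree p) = 0"
      using lead_coeff_comp[of "[:1, 1:]" p] by (simp add: degree_pcompose)
    ultimately have "degree ?q < degree p"
      using False by (metis degree_0 le_neq_implies_less leading_coeff_0_iff neq0_conv)
    with Suc.prems have "degree ?q < n" by simp
    from Suc.IH[OF this] show ?thesis
      unfolding alternating_binomial_sum_Suc shift .
  qed
qed simp

text \<open>Terms with \<open>l > k\<close> vanish through the binomial coefficient and terms with
  \<open>l > m\<close> through the degree. The range thus no longer depends on \<open>k\<close>,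
  which later permits interchanging this sum with one over \<open>k\<close>.\<close>

lemma newton_expansion_poly:
  fixes p :: "'a::idom poly"
  assumes "degree p \<le> m"
  shows "poly p (of_nat k) = (\<Sum>l\<le>m. (-1) ^ l * of_nat (k choose l) *
            (\<Sum>i\<le>l. (-1) ^ i * of_nat (l choose i) * poly p (of_nat i)))" (is "_ = (\<Sum>l\<le>m. ?t l)")
proof -
  have "poly p (of_nat k) = (\<Sum>l\<le>k. ?t l)"
    by (rule binomial_inversion_alternating)
  also have "\<dots> = (\<Sum>l\<le>k+m. ?t l)"
    by (rule sum.mono_neutral_left) (auto simp: binomial_eq_0)
  also have "\<dots> = (\<Sum>l\<le>m. ?t l)"
    by (rule sum.mono_neutral_right) (use assms in \<open>auto simp: alternating_binomial_sum_poly_eq_0\<close>)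
  finally show ?thesis .
qed

section \<open>Coefficients of the Miller-Paris transformation\<close>

lemma pochhammer_minus_nat_div_fact:
  "pochhammer (- of_nat l) i / fact i = ((-1) ^ i * of_nat (l choose i) :: 'a::field_char_0)"
  using gbinomial_pochhammer[of "of_nat l :: 'a" i]
  by (simp add: binomial_gbinomial flip: mult.assoc power_mult_distrib)

lemma pochhammer_shift_swap:
  fixes x :: "'a::comm_ring_1"
  shows "pochhammer x n * pochhammer (x + of_nat n) k = pochhammer x k * pochhammer (x + of_nat k) n"
  by (simp flip: pochhammer_product' add: add.commute)

lemma poly_pochhammer_linear:
  "poly (pochhammer [:s, 1:] n) t = pochhammer (t + s :: 'a::comm_ring_1) n"
  by (induction n) (simp_all add: pochhammer_Suc algebra_simps of_nat_poly)

lemma degree_pochhammer_linear_le: "degree (pochhammer [:s :: 'a::comm_ring_1, 1:] n) \<le> n"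
proof (induction n)
  case (Suc n)
  have "degree ([:s, 1:] + of_nat n) \<le> 1"
    by (simp add: of_nat_poly)
  then show ?case
    using Suc degree_mult_le[of "pochhammer [:s, 1:] n" "[:s, 1:] + of_nat n"]
    by (simp add: pochhammer_Suc)
qed simp

text \<open>By \<open>pochhammer_shift_swap\<close>, each quotient \<open>(f + q)_k / (f)_k\<close>
  equals \<open>(f + k)_q / (f)_q\<close>, a polynomial in \<open>k\<close> of degree at most
  \<open>q\<close>. This is where the integrality of the parameter differences enters.\<close>

lemma shift_params_ratio_poly:
  assumes "length fs = length ms" "set fs \<inter> \<int>\<^sub>\<le>\<^sub>0 = {}"
  shows "\<exists>P. degree P \<le> sum_list ms \<and>
    (\<forall>k. poly P (of_nat k) = (\<Prod>x\<leftarrow>shift_params fs ms. pochhammer x k) / (\<Prod>x\<leftarrow>fs. pochhammer x k))"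
  using assms
proof (induction fs ms rule: list_induct2)
  case Nil
  show ?case by (rule exI[of _ 1]) (simp add: shift_params_def)
next
  case (Cons f fs q ms)
  then obtain P where P: "degree P \<le> sum_list ms"
    "\<And>k. poly P (of_nat k) = (\<Prod>x\<leftarrow>shift_params fs ms. pochhammer x k) / (\<Prod>x\<leftarrow>fs. pochhammer x k)"
    by auto
  have f: "pochhammer f n \<noteq> 0" for n
    using Cons.prems pochhammer_eq_0_imp_nonpos_Int by auto
  define R where "R = smult (1 / pochhammer f q) (pochhammer [:f, 1:] q)"
  have "degree R \<le> q"
    unfolding R_def using degree_pochhammer_linear_le degree_smult_le le_trans by blast
  then have "degree (R * P) \<le> q + sum_list ms"
    using degree_mult_le[of R P] P(1) by linarith
  moreover have "poly R (of_nat k) = pochhammer (f + of_nat q) k / pochhammer f k" for k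
    using f[of q] f[of k] pochhammer_shift_swap[of f q k]
    by (simp add: R_def poly_pochhammer_linear field_simps)
  ultimately show ?case
    by (intro exI[of _ "R * P"]) (simp add: P(2) shift_params_def)
qed

text \<open>The left side is the coefficient of \<open>x^n\<close> in \<open>(1 - x)^(-la)\<close>
  times \<open>2F1(A, B; ga; x)\<close>. Dividing the denominator-free transformation by
  \<open>(ga)_n n!\<close> gives the claim.\<close>

lemma binomial_convolution_3F2:
  fixes A B ga la mu :: "'a::field_char_0"
  assumes mu: "mu = A + B + la - ga" and ga: "pochhammer ga n \<noteq> 0"
  shows "(\<Sum>i\<le>n. pochhammer la (n - i) / fact (n - i) * (pochhammer A i * pochhammer B i / (pochhammer ga i * fact i))) =
         (\<Sum>i\<le>n. of_nat (n choose i) * (-1) ^ i * pochhammer mu i * pochhammer la i *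
            pochhammer (A + la + of_nat i) (n - i) * pochhammer (B + la + of_nat i) (n - i)) /
         (pochhammer ga n * fact n)"
proof -
  have "(\<Sum>i\<le>n. of_nat (n choose i) * pochhammer la (n - i) * pochhammer A i * pochhammer B i *
            pochhammer (ga + of_nat i) (n - i)) / (pochhammer ga n * fact n) =
    (\<Sum>i\<le>n. pochhammer la (n - i) / fact (n - i) * (pochhammer A i * pochhammer B i / (pochhammer ga i * fact i)))"
    unfolding sum_divide_distrib
  proof (rule sum.cong[OF refl])
    fix i assume "i \<in> {..n}"
    then have i: "i \<le> n" by simp
    from pochhammer_product[OF i, of ga] ga
    show "of_nat (n choose i) * pochhammer la (n - i) * pochhammer A i * pochhammer B i *
            pochhammer (ga + of_nat i) (n - i) / (pochhammer ga n * fact n) =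
       pochhammer la (n - i) / fact (n - i) * (pochhammer A i * pochhammer B i / (pochhammer ga i * fact i))"
      by (simp add: binomial_fact[OF i])
  qed
  then show ?thesis
    unfolding terminating_3F2_transformation[OF mu] ..
qed

text \<open>Either of \<open>-p\<close> and \<open>-n\<close> terminates the series, so the ranges
  up to \<open>p\<close>, \<open>n\<close> and \<open>min p n\<close> give equal sums. Only indices
  up to \<open>p\<close> have guaranteed nonzero lower Pochhammer symbols, hence the cancellation
  takes place on the smallest range.\<close>

lemma hypF_terminating_3F2_clear_denominators:
  assumes al: "pochhammer al p \<noteq> 0" and be: "pochhammer be p \<noteq> 0"
  shows "pochhammer al n * pochhammer be n * hypF [- of_nat p, - of_nat n, la] [al, be] =
    (\<Sum>i\<le>n. of_nat (n choose i) * (-1) ^ i * pochhammer (- of_nat p) i * pochhammer la i *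
            pochhammer (al + of_nat i) (n - i) * pochhammer (be + of_nat i) (n - i))"
    (is "_ = (\<Sum>i\<le>n. ?R i)")
proof -
  define L where "L = (\<lambda>i. pochhammer al n * pochhammer be n *
    (pochhammer (- of_nat p) i * (pochhammer (- of_nat n) i * pochhammer la i) /
        (pochhammer al i * pochhammer be i * fact i)))"
  have "pochhammer al n * pochhammer be n * hypF [- of_nat p, - of_nat n, la] [al, be] = (\<Sum>i\<le>p. L i)"
    unfolding hypF_terminating by (simp add: L_def sum_distrib_left)
  also have "\<dots> = (\<Sum>i\<le>min p n. L i)"
    by (rule sum.mono_neutral_right) (auto simp: L_def pochhammer_of_nat_eq_0_iff)
  also have "\<dots> = (\<Sum>i\<le>min p n. ?R i)"
  proof (rule sum.cong[OF refl])
    fix i assume "i \<in> {..min p n}"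
    then have i: "i \<le> p" "i \<le> n" by auto
    have nz: "pochhammer al i \<noteq> 0" "pochhammer be i \<noteq> 0"
      using i al be pochhammer_neq_0_mono by blast+
    have "L i = pochhammer al n * pochhammer be n * pochhammer (- of_nat p) i * pochhammer la i *
        (pochhammer (- of_nat n) i / fact i) / (pochhammer al i * pochhammer be i)"
      by (simp add: L_def mult_ac)
    also have "\<dots> = ?R i"
      unfolding pochhammer_minus_nat_div_fact pochhammer_product[OF i(2), of al] pochhammer_product[OF i(2), of be]
      using nz by simp
    finally show "L i = ?R i" .
  qed
  also have "\<dots> = (\<Sum>i\<le>n. ?R i)"
    by (rule sum.mono_neutral_left) (auto simp: pochhammer_of_nat_eq_0_iff)
  finally show ?thesis .
qed

text \<open>This is the contribution of one Newton basis term. The factor \<open>i choose l\<close>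
  removes all \<open>i < l\<close>; shifting \<open>i\<close> by \<open>l\<close> then moves
  \<open>a\<close>, \<open>b\<close>, \<open>c\<close> to \<open>a + l\<close>,
  \<open>b + l\<close>, \<open>c + l\<close> and leaves a plain convolution of the kind already
  transformed. The outcome is a summand of \<open>Qhat\<close> at \<open>t = -j\<close>.\<close>

lemma Miller_Paris_coefficient:
  assumes l: "l \<le> m" and la: "la = c - a - b - of_nat m"
    and c: "\<And>n. pochhammer c n \<noteq> 0"
    and al: "pochhammer (a + la) m \<noteq> 0" and be: "pochhammer (b + la) m \<noteq> 0"
  shows "(\<Sum>i\<le>j. pochhammer la (j - i) / fact (j - i) *
      (pochhammer a i * pochhammer b i / (pochhammer c i * fact i) * ((-1) ^ l * of_nat (i choose l)))) =
    pochhammer (a + la) j * pochhammer (b + la) j / (pochhammer c j * fact j) *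
    (pochhammer a l * pochhammer b l * pochhammer (- of_nat j) l /
      (pochhammer (b + la) l * pochhammer (a + la) l * fact l) *
     hypF [- of_nat m + of_nat l, - of_nat j + of_nat l, la] [b + la + of_nat l, a + la + of_nat l])"
    (is "sum ?t _ = ?rhs")
proof (cases "l \<le> j")
  case False
  then show ?thesis by (simp add: pochhammer_of_nat_eq_0_iff binomial_eq_0)
next
  case True
  define J where "J = j - l"
  have j: "j = l + J" using True by (simp add: J_def)
  define al' where "al' = a + la + of_nat l"
  define be' where "be' = b + la + of_nat l"
  let ?S = "\<Sum>i\<le>J. of_nat (J choose i) * (-1) ^ i * pochhammer (- of_nat (m - l)) i * pochhammer la i *
            pochhammer (al' + of_nat i) (J - i) * pochhammer (be' + of_nat i) (J - i)"
  have split: "pochhammer (a + la) m = pochhammer (a + la) l * pochhammer al' (m - l)"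
    "pochhammer (b + la) m = pochhammer (b + la) l * pochhammer be' (m - l)"
    unfolding al'_def be'_def by (rule pochhammer_product[OF l])+
  have c': "pochhammer (c + of_nat l) i \<noteq> 0" for i
    using c[of "l + i"] by (simp add: pochhammer_product')
  have hyp: "pochhammer al' J * pochhammer be' J *
      hypF [- of_nat m + of_nat l, - of_nat j + of_nat l, la] [be', al'] = ?S"
  proof -
    have "hypF [- of_nat m + of_nat l, - of_nat j + of_nat l, la] [be', al'] =
        hypF [- of_nat (m - l), - of_nat J, la] [al', be']"
      using l by (simp add: j hypF_def of_nat_diff mult_ac)
    then show ?thesis
      using hypF_terminating_3F2_clear_denominators[of al' "m - l" be' J la] al be split by auto
  qed
  have "sum ?t {..j} = (\<Sum>i\<in>{l..l+J}. ?t i)"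
    by (rule sum.mono_neutral_right) (auto simp: j)
  also have "\<dots> = (\<Sum>i\<le>J. ?t (i + l))"
    using sum.shift_bounds_cl_nat_ivl[of ?t 0 l J] by (simp add: atLeast0AtMost add.commute)
  also have "\<dots> = (\<Sum>i\<le>J. (-1) ^ l * pochhammer a l * pochhammer b l / (pochhammer c l * fact l) *
     (pochhammer la (J - i) / fact (J - i) *
      (pochhammer (a + of_nat l) i * pochhammer (b + of_nat l) i / (pochhammer (c + of_nat l) i * fact i))))"
  proof (rule sum.cong[OF refl])
    fix i
    have "of_nat (i + l choose l) / fact (i + l) = (1 / (fact l * fact i) :: complex)"
      by (simp add: binomial_fact)
    moreover have "?t (i + l) = pochhammer la (J - i) / fact (J - i) *
      (pochhammer a (l + i) * pochhammer b (l + i) / pochhammer c (l + i) * ((-1) ^ l * (of_nat (i + l choose l) / fact (i + l))))"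
      by (simp add: j add.commute)
    ultimately show "?t (i + l) = (-1) ^ l * pochhammer a l * pochhammer b l / (pochhammer c l * fact l) *
     (pochhammer la (J - i) / fact (J - i) *
      (pochhammer (a + of_nat l) i * pochhammer (b + of_nat l) i / (pochhammer (c + of_nat l) i * fact i)))"
      by (simp add: pochhammer_product'[of _ l] mult_ac)
  qed
  also have "\<dots> = (-1) ^ l * pochhammer a l * pochhammer b l / (pochhammer c l * fact l) *
     (?S / (pochhammer (c + of_nat l) J * fact J))"
  proof -
    \<comment> \<open>The value of \<open>la\<close> makes the parameter \<open>mu\<close> the
      non-positive integer \<open>l - m\<close>. This is the upper parameter \<open>-m + k\<close>
      of the inner 3F2 in \<open>Qhat\<close>.\<close>
    have "- of_nat (m - l) = (a + of_nat l) + (b + of_nat l) + la - (c + of_nat l)"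
      using l by (simp add: la of_nat_diff)
    from binomial_convolution_3F2[OF this c'] show ?thesis
      unfolding sum_distrib_left[symmetric] by (simp add: al'_def be'_def add_ac)
  qed
  also have "\<dots> = ?rhs"
  proof -
    \<comment> \<open>The shifted sum carries \<open>(j - l)!\<close> where the target has
      \<open>j!\<close>; the factor \<open>(-j)_l\<close> accounts for the difference and for the
      sign \<open>(-1) ^ l\<close>.\<close>
    have "pochhammer (- of_nat j) l / (fact j :: complex) = (-1) ^ l / fact J"
      using pochhammer_minus_nat_div_fact[of j l, where 'a = complex]
      by (simp add: j binomial_fact field_simps)
    then have 1: "pochhammer (- of_nat j) l = ((-1) ^ l / fact J * fact j :: complex)"
      by (simp add: field_simps)
    have nz: "pochhammer (a + la) l \<noteq> 0" "pochhammer (b + la) l \<noteq> 0"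
      using al be split by auto
    have 2: "pochhammer (a + la) j = pochhammer (a + la) l * pochhammer al' J"
       "pochhammer (b + la) j = pochhammer (b + la) l * pochhammer be' J"
       "pochhammer c j = pochhammer c l * pochhammer (c + of_nat l) J"
      by (simp_all add: j pochhammer_product' al'_def be'_def)
    show ?thesis
      unfolding hyp[symmetric] 1 2 al'_def[symmetric] be'_def[symmetric]
      using nz c[of l] c'[of J] by (simp add: field_simps)
  qed
  finally show ?thesis .
qed

text \<open>The preceding lemma is summed against the Newton coefficients \<open>H l\<close> of the
  parameter quotient, which are exactly the series \<open>F(-l, f + m; f)\<close> in
  \<open>Qhat\<close>.\<close>

lemma Miller_Paris_convolution:
  assumes len: "length fs = length ms" and fs: "set fs \<inter> \<int>\<^sub>\<le>\<^sub>0 = {}"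
    and m: "m = sum_list ms" and la: "la = c - a - b - of_nat m"
    and c: "\<And>n. pochhammer c n \<noteq> 0"
    and al: "pochhammer (a + la) m \<noteq> 0" and be: "pochhammer (b + la) m \<noteq> 0"
  shows "(\<Sum>i\<le>j. pochhammer la (j - i) / fact (j - i) *
      (pochhammer a i * pochhammer b i / (pochhammer c i * fact i) *
        ((\<Prod>x\<leftarrow>shift_params fs ms. pochhammer x i) / (\<Prod>x\<leftarrow>fs. pochhammer x i)))) =
    pochhammer (a + la) j * pochhammer (b + la) j / (pochhammer c j * fact j) * Qhat a b c fs ms (- of_nat j)"
proof -
  obtain P where P: "degree P \<le> m" and
    P_eq: "\<And>k. poly P (of_nat k) = (\<Prod>x\<leftarrow>shift_params fs ms. pochhammer x k) / (\<Prod>x\<leftarrow>fs. pochhammer x k)"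
    using shift_params_ratio_poly[OF len fs] m by blast
  define H where "H = (\<lambda>l. hypF (- of_nat l # shift_params fs ms) fs)"
  have H: "H l = (\<Sum>i\<le>l. (-1) ^ i * of_nat (l choose i) * poly P (of_nat i))" for l
    unfolding H_def hypF_terminating P_eq pochhammer_minus_nat_div_fact[symmetric] by (simp add: mult_ac)
  have P_newton: "poly P (of_nat i) = (\<Sum>l\<le>m. (-1) ^ l * of_nat (i choose l) * H l)" for i
    unfolding H by (rule newton_expansion_poly[OF P])
  have bl: "c - a - of_nat m = b + la" and al_eq: "c - b - of_nat m = a + la"
    by (simp_all add: la)
  have "(\<Sum>i\<le>j. pochhammer la (j - i) / fact (j - i) *
      (pochhammer a i * pochhammer b i / (pochhammer c i * fact i) * poly P (of_nat i))) =
    (\<Sum>i\<le>j. \<Sum>l\<le>m. H l * (pochhammer la (j - i) / fact (j - i) *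
      (pochhammer a i * pochhammer b i / (pochhammer c i * fact i) * ((-1) ^ l * of_nat (i choose l)))))"
    unfolding P_newton sum_distrib_left by (simp only: mult_ac)
  also have "\<dots> = (\<Sum>l\<le>m. H l * (\<Sum>i\<le>j. pochhammer la (j - i) / fact (j - i) *
      (pochhammer a i * pochhammer b i / (pochhammer c i * fact i) * ((-1) ^ l * of_nat (i choose l)))))"
    unfolding sum_distrib_left by (rule sum.swap)
  also have "\<dots> = (\<Sum>l\<le>m. H l * (pochhammer (a + la) j * pochhammer (b + la) j / (pochhammer c j * fact j) *
      (pochhammer a l * pochhammer b l * pochhammer (- of_nat j) l /
        (pochhammer (b + la) l * pochhammer (a + la) l * fact l) *
       hypF [- of_nat m + of_nat l, - of_nat j + of_nat l, la] [b + la + of_nat l, a + la + of_nat l])))"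
    by (rule sum.cong[OF refl]) (simp only: Miller_Paris_coefficient[OF _ la c al be] atMost_iff)
  also have "\<dots> = pochhammer (a + la) j * pochhammer (b + la) j / (pochhammer c j * fact j) * Qhat a b c fs ms (- of_nat j)"
    unfolding Qhat_def Let_def m[symmetric] la[symmetric] bl al_eq sum_distrib_left H_def
    by (rule sum.cong[OF refl]) (simp add: mult_ac)
  finally show ?thesis unfolding P_eq .
qed

section \<open>Inverting the convolution and passing to zeros\<close>

text \<open>The generating series of \<open>(x)_n / n!\<close> is \<open>(1 - X)^(-x)\<close>. By
  Chu-Vandermonde these series multiply by adding exponents, so the one for \<open>- la\<close>
  inverts the one for \<open>la\<close>.\<close>

lemma pochhammer_convolution_inverse:
  fixes la :: "'a::field_char_0"
  assumes C: "\<And>j. C j = (\<Sum>i\<le>j. pochhammer la (j - i) / fact (j - i) * A i)"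
  shows "A k = (\<Sum>j\<le>k. pochhammer (- la) (k - j) / fact (k - j) * C j)"
proof -
  define E where "E = (\<lambda>x::'a. Abs_fps (\<lambda>n. pochhammer x n / fact n))"
  have "E x * E y = E (x + y)" for x y
    unfolding E_def
    by (rule fps_ext)
       (simp add: fps_mult_nth pochhammer_binomial_sum binomial_fact sum_divide_distrib atLeast0AtMost)
  then have "E (- la) * E la = E 0" by simp
  also have "E 0 = 1"
    by (rule fps_ext) (simp add: E_def pochhammer_0_left)
  finally have inv: "E (- la) * E la = 1" .
  have conv: "fps_nth (F * E x) n = (\<Sum>i\<le>n. pochhammer x (n - i) / fact (n - i) * fps_nth F i)" for F x n
    by (simp add: fps_mult_nth E_def atLeast0AtMost mult.commute)
  have "Abs_fps C = Abs_fps A * E la"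
    by (rule fps_ext) (simp add: conv C)
  then have "Abs_fps A = Abs_fps C * E (- la)"
    using inv by (simp add: mult.assoc mult.commute[of "E la"])
  from arg_cong[OF this, of "\<lambda>F. fps_nth F k"] show ?thesis
    by (simp add: conv)
qed

lemma prod_list_one: "(\<Prod>x\<leftarrow>xs. 1) = (1 :: 'a::monoid_mult)"
  by (induction xs) simp_all

lemma poly_prod_list_linear: "poly (\<Prod>z\<leftarrow>zs. [:- z, 1:]) x = (\<Prod>z\<leftarrow>zs. x - z :: 'a::comm_ring_1)"
  by (induction zs) (simp_all add: algebra_simps)

text \<open>Each zero contributes \<open>(z + 1)_j / (z)_j = (-j - z) / (0 - z)\<close>, so the
  product over the zeros with multiplicity is \<open>Q(-j) / Q(0)\<close>; the leading coefficient
  cancels.\<close>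

lemma prod_list_pochhammer_shift_zeros:
  fixes Q :: "complex poly"
  assumes zs: "mset zs = proots Q" and nz: "set zs \<inter> \<int>\<^sub>\<le>\<^sub>0 = {}"
  shows "(\<Prod>z\<leftarrow>zs. pochhammer (z + 1) j) / (\<Prod>z\<leftarrow>zs. pochhammer z j) * poly Q 0 = poly Q (- of_nat j)"
proof -
  have "Q = smult (lead_coeff Q) (\<Prod>x\<in>#mset zs. [:-x, 1:])"
    unfolding zs by (rule complex_poly_decompose_multiset[symmetric])
  also have "\<dots> = smult (lead_coeff Q) (\<Prod>x\<leftarrow>zs. [:-x, 1:])"
    by (metis mset_map prod_mset_prod_list)
  finally have "Q = smult (lead_coeff Q) (\<Prod>x\<leftarrow>zs. [:-x, 1:])" .
  from arg_cong[OF this, of "\<lambda>p. poly p x" for x]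
  have Q: "poly Q x = lead_coeff Q * (\<Prod>z\<leftarrow>zs. x - z)" for x
    by (simp only: poly_smult poly_prod_list_linear)
  have "(\<Prod>z\<leftarrow>zs. pochhammer (z + 1) j) * (\<Prod>z\<leftarrow>zs. 0 - z) =
      (\<Prod>z\<leftarrow>zs. - of_nat j - z) * (\<Prod>z\<leftarrow>zs. pochhammer z j)"
  proof (induction zs)
    case (Cons z zs)
    have "pochhammer (z + 1) j * (0 - z) = (- of_nat j - z) * pochhammer z j"
      using pochhammer_rec[of z j] pochhammer_rec'[of z j] by (simp add: algebra_simps)
    from arg_cong2[OF this Cons, of "(*)"] show ?case
      by (simp only: list.map prod_list.Cons mult_ac)
  qed simp
  moreover have "(\<Prod>z\<leftarrow>zs. pochhammer z j) \<noteq> 0"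
    using nz by (auto simp: prod_list_zero_iff dest!: pochhammer_eq_0_imp_nonpos_Int)
  moreover have "x / y * (k * u) = k * v" if "x * u = v * y" "y \<noteq> 0" for k u v x y :: complex
    using that by (simp add: field_simps)
  ultimately show ?thesis
    unfolding Q by blast
qed

section \<open>The weighted tail sums and the final identity\<close>

text \<open>Needed for the index \<open>n - 1\<close> at \<open>n = 0\<close>. The case
  \<open>z = 1\<close> is a true exception: \<open>Gamma 0\<close> is 0 in HOL, so the product would
  be 0.\<close>

lemma poch_int_minus_one:
  assumes "z \<notin> \<int>\<^sub>\<le>\<^sub>0" "z \<noteq> 1"
  shows "poch_int z (- 1) * (z - 1) = 1"
proof -
  have "z - 1 \<notin> \<int>\<^sub>\<le>\<^sub>0"
  proof
    assume "z - 1 \<in> \<int>\<^sub>\<le>\<^sub>0"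
    then obtain k where k: "z - 1 = - of_nat k" by (rule nonpos_Ints_cases')
    then obtain k' where "k = Suc k'" using assms(2) by (cases k) auto
    with k have "z = - of_nat k'" by (simp add: algebra_simps add_eq_0_iff2)
    with assms(1) show False by simp
  qed
  then have "Gamma z = (z - 1) * Gamma (z - 1)" "Gamma (z - 1) \<noteq> 0"
    using Gamma_plus1[of "z - 1"] by (simp_all add: Gamma_eq_zero_iff)
  moreover have "Gamma z \<noteq> 0" using assms(1) by (simp add: Gamma_eq_zero_iff)
  ultimately show ?thesis by (simp add: poch_int_def)
qed

text \<open>Pulling out the factors of index \<open>j\<close> leaves
  \<open>3F2(-N, -la, d + j; g + j, e + j; 1)\<close> with \<open>N = Suc p - j\<close>. Its
  parametric excess is 2 for every \<open>j\<close>, because the shifts cancel in the balance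
  condition.\<close>

lemma near_Saalschutz_tail:
  fixes d e g la :: complex
  assumes bal: "g + e + of_nat (Suc p) + la - d = 2" and j: "j \<le> Suc p"
    and g: "\<And>k. pochhammer g k \<noteq> 0" and e: "\<And>k. pochhammer e k \<noteq> 0"
    and gl: "\<And>k. pochhammer (g + la) k \<noteq> 0" and el: "\<And>k. pochhammer (e + la) k \<noteq> 0"
  shows "(\<Sum>i\<le>Suc p - j. pochhammer (- of_nat (Suc p)) (j + i) * pochhammer d (j + i) /
            (pochhammer g (j + i) * pochhammer e (j + i)) * (pochhammer (- la) i / fact i)) =
    pochhammer (- of_nat (Suc p)) j * pochhammer d j * (pochhammer (g + la) p * pochhammer (e + la) p *
      (of_nat (Suc p - j) * (d + of_nat j) + (g + la + of_nat j - 1) * (e + la + of_nat j - 1))) /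
    (pochhammer g (Suc p) * pochhammer e (Suc p) * (pochhammer (g + la) j * pochhammer (e + la) j))"
proof -
  define N where "N = Suc p - j"
  have N: "Suc p = j + N" using j by (simp add: N_def)
  define t where "t = (\<lambda>i. of_nat (N choose i) * (-1) ^ i * pochhammer (- la) i * pochhammer (d + of_nat j) i *
            pochhammer (g + of_nat j + of_nat i) (N - i) * pochhammer (e + of_nat j + of_nat i) (N - i))"
  \<comment> \<open>The closed form has Pochhammer index \<open>N - 1\<close>. Multiplying by
    \<open>(g + la)_j (e + la)_j\<close> turns this into the fixed index \<open>p\<close>, which
    also makes sense for \<open>N = 0\<close>; there the linear factor supplies the last factors of
    the symbols of index \<open>Suc p\<close>.\<close>
  have main: "pochhammer (g + la) j * pochhammer (e + la) j * (\<Sum>i\<le>N. t i) =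
    pochhammer (g + la) p * pochhammer (e + la) p *
      (of_nat N * (d + of_nat j) + (g + la + of_nat j - 1) * (e + la + of_nat j - 1))"
  proof (cases N)
    case 0
    then have "j = Suc p" using N by simp
    then show ?thesis using 0 by (simp add: t_def pochhammer_Suc add.assoc)
  next
    case (Suc q)
    have p: "p = j + q" using N Suc by simp
    have "(\<Sum>i\<le>N. t i) = pochhammer (g + of_nat j - - la) q * pochhammer (e + of_nat j - - la) q *
      (of_nat N * (d + of_nat j) + (g + of_nat j - - la - 1) * (e + of_nat j - - la - 1))"
      unfolding t_def Suc
    proof (rule near_Saalschutz_sum)
      have "g + e + of_nat j + of_nat N = 2 - la + d"
        using bal unfolding N by (simp add: algebra_simps)
      then show "g + of_nat j + (e + of_nat j) + of_nat (Suc q) = 2 + - la + (d + of_nat j)"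
        unfolding Suc by (simp add: algebra_simps)
    qed
    moreover have "x + of_nat j - - la = x + la + of_nat j" for x by simp
    ultimately show ?thesis
      unfolding p pochhammer_product' by (simp only: mult_ac)
  qed
  have "(\<Sum>i\<le>N. pochhammer (- of_nat (Suc p)) (j + i) * pochhammer d (j + i) /
            (pochhammer g (j + i) * pochhammer e (j + i)) * (pochhammer (- la) i / fact i)) =
    (\<Sum>i\<le>N. pochhammer (- of_nat (Suc p)) j * pochhammer d j / (pochhammer g (Suc p) * pochhammer e (Suc p)) * t i)"
  proof (rule sum.cong[OF refl])
    fix i assume "i \<in> {..N}"
    then have i: "i \<le> N" by simp
    have split: "pochhammer x (Suc p) = pochhammer x (j + i) * pochhammer (x + of_nat j + of_nat i) (N - i)" for x :: complex
      using pochhammer_product[of "j + i" "j + N" x] i by (simp add: N add.assoc)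
    have n: "pochhammer (- of_nat (Suc p)) (j + i) = pochhammer (- of_nat (Suc p)) j * (pochhammer (- of_nat N) i :: complex)"
    proof -
      have "- of_nat (Suc p) + of_nat j = (- of_nat N :: complex)" unfolding N by simp
      then show ?thesis by (simp only: pochhammer_product')
    qed
    have "pochhammer (- of_nat (Suc p)) (j + i) * pochhammer d (j + i) /
            (pochhammer g (j + i) * pochhammer e (j + i)) * (pochhammer (- la) i / fact i) =
      pochhammer (- of_nat (Suc p)) j * pochhammer d j * pochhammer (d + of_nat j) i * pochhammer (- la) i *
      (pochhammer (- of_nat N) i / fact i) / (pochhammer g (j + i) * pochhammer e (j + i))"
      unfolding n pochhammer_product'[of d] by (simp add: mult_ac)
    then show "pochhammer (- of_nat (Suc p)) (j + i) * pochhammer d (j + i) /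
            (pochhammer g (j + i) * pochhammer e (j + i)) * (pochhammer (- la) i / fact i) =
      pochhammer (- of_nat (Suc p)) j * pochhammer d j / (pochhammer g (Suc p) * pochhammer e (Suc p)) * t i"
      unfolding pochhammer_minus_nat_div_fact t_def split[of g] split[of e]
      using g[of "Suc p", unfolded split] e[of "Suc p", unfolded split] by (simp add: mult_ac)
  qed
  also have "\<dots> = pochhammer (- of_nat (Suc p)) j * pochhammer d j / (pochhammer g (Suc p) * pochhammer e (Suc p)) * (\<Sum>i\<le>N. t i)"
    by (simp only: sum_distrib_left)
  also have "\<dots> = pochhammer (- of_nat (Suc p)) j * pochhammer d j *
     (pochhammer (g + la) j * pochhammer (e + la) j * (\<Sum>i\<le>N. t i)) /
    (pochhammer g (Suc p) * pochhammer e (Suc p) * (pochhammer (g + la) j * pochhammer (e + la) j))"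
    using gl[of j] el[of j] by simp
  finally show ?thesis
    unfolding main N_def[symmetric] .
qed

theorem mainTheorem7:
  fixes r m n :: nat
    and ms :: "nat list"
    and fs zs :: "complex list"
    and a b c d e g lam nu B :: complex
    and Q :: "complex poly"
  assumes len_ms: "length ms = r"
    and len_fs: "length fs = r"
    and m_eq: "m = sum_list ms"
    and lam_eq: "lam = c - a - b - of_nat m"
    and balance: "g + e + of_nat n + lam - d = 2"
    and nz1: "pochhammer (1 + a + b - c) m \<noteq> 0"
    and nz2: "pochhammer (c - a - of_nat m) m \<noteq> 0"
    and nz3: "pochhammer (c - b - of_nat m) m \<noteq> 0"
    and nu_denom: "g + e + of_nat n - d + 2 * (lam - 1) \<noteq> 0"
    and nu_eq: "nu = (of_nat n * d + (g + lam - 1) * (e + lam - 1)) /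
                     (g + e + of_nat n - d + 2 * (lam - 1))"
    and B_eq: "B = poch_int (g + lam) (int n - 1) * poch_int (e + lam) (int n - 1) /
                   (pochhammer g n * pochhammer e n) *
                   (of_nat n * d + (g + lam - 1) * (e + lam - 1))"
    and Q_eq: "\<And>t. poly Q t = Qhat a b c fs ms t"
    and deg_Q: "degree Q = m"
    and zeros: "mset zs = proots Q"
    and lower_left: "set ([c, g, e] @ fs) \<inter> \<int>\<^sub>\<le>\<^sub>0 = {}"
    and lower_right: "set ([c, g + lam, e + lam, nu] @ zs) \<inter> \<int>\<^sub>\<le>\<^sub>0 = {}"
  shows "hypF ([- of_nat n, a, b, d] @ shift_params fs ms) ([c, g, e] @ fs) =
         B * hypF ([- of_nat n, a + lam, b + lam, d, nu + 1] @ map (\<lambda>z. z + 1) zs)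
                  ([c, g + lam, e + lam, nu] @ zs)"
proof (cases n)
  case 0
  \<comment> \<open>Both series are 1 here, so \<open>B = 1\<close> is the whole claim. The
    numerator of \<open>nu\<close> is now \<open>(g + lam - 1) * (e + lam - 1)\<close>, and
    \<open>nu\<close> being an admissible lower parameter keeps both factors away from 0.\<close>
  have "nu \<noteq> 0" using lower_right by auto
  then have "g + lam \<noteq> 1" "e + lam \<noteq> 1" using nu_eq 0 by auto
  then have "poch_int (g + lam) (- 1) * (g + lam - 1) = 1" "poch_int (e + lam) (- 1) * (e + lam - 1) = 1"
    using lower_right by (auto intro!: poch_int_minus_one)
  then have "B = 1"
    unfolding B_eq 0 by (simp add: mult_ac)
  then show ?thesis
    unfolding append_Cons hypF_terminating 0 by (simp add: prod_list_one)
next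
  case (Suc p)
  define den where "den = g + e + of_nat n - d + 2 * (lam - 1)"
  have poch_nz: "pochhammer x k \<noteq> 0" if "x \<in> set ([c, g, e] @ fs) \<union> set ([c, g + lam, e + lam, nu] @ zs)" for x k
    using that lower_left lower_right pochhammer_eq_0_imp_nonpos_Int[of x k] by blast
  have nz: "pochhammer c k \<noteq> 0" "pochhammer g k \<noteq> 0" "pochhammer e k \<noteq> 0"
    "pochhammer (g + lam) k \<noteq> 0" "pochhammer (e + lam) k \<noteq> 0" "pochhammer nu k \<noteq> 0" for k
    by (rule poch_nz; simp)+
  \<comment> \<open>\<open>A\<close> collects the Taylor coefficients of
    \<open>F(a, b, f + m; c, f | x)\<close>, and \<open>C\<close> those of its product with
    \<open>(1 - x)^(-lam)\<close>.\<close>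
  define A where "A = (\<lambda>k. pochhammer a k * pochhammer b k / (pochhammer c k * fact k) *
        ((\<Prod>x\<leftarrow>shift_params fs ms. pochhammer x k) / (\<Prod>x\<leftarrow>fs. pochhammer x k)))"
  define C where "C = (\<lambda>j. pochhammer (a + lam) j * pochhammer (b + lam) j / (pochhammer c j * fact j) *
        Qhat a b c fs ms (- of_nat j))"
  have al: "c - b - of_nat m = a + lam" and be: "c - a - of_nat m = b + lam"
    by (simp_all add: lam_eq)
  have C_conv: "C j = (\<Sum>i\<le>j. pochhammer lam (j - i) / fact (j - i) * A i)" for j
  proof -
    have "pochhammer (a + lam) m \<noteq> 0" "pochhammer (b + lam) m \<noteq> 0"
      using nz2 nz3 unfolding al be by simp_all
    moreover have "length fs = length ms" "set fs \<inter> \<int>\<^sub>\<le>\<^sub>0 = {}"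
      using len_ms len_fs lower_left by auto
    ultimately show ?thesis
      unfolding C_def A_def using m_eq lam_eq nz(1) by (intro Miller_Paris_convolution[symmetric])
  qed
  have A_conv: "A k = (\<Sum>j\<le>k. pochhammer (- lam) (k - j) / fact (k - j) * C j)" for k
    by (rule pochhammer_convolution_inverse[OF C_conv])
  \<comment> \<open>The convolution at \<open>j = 0\<close> yields the normalization
    \<open>Q(0) = 1\<close>, so the quotient over the zeros is \<open>Q(-j)\<close> itself.\<close>
  have "Qhat a b c fs ms 0 = 1"
    using C_conv[of 0] by (simp add: C_def A_def prod_list_one)
  then have zs_ratio: "(\<Prod>z\<leftarrow>zs. pochhammer (z + 1) j) / (\<Prod>z\<leftarrow>zs. pochhammer z j) = Qhat a b c fs ms (- of_nat j)" for j
    using prod_list_pochhammer_shift_zeros[OF zeros, of j] lower_right by (auto simp: Q_eq)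
  have nu_den: "nu * den = of_nat n * d + (g + lam - 1) * (e + lam - 1)"
    using nu_eq nu_denom by (simp add: den_def)
  have B: "B = pochhammer (g + lam) p * pochhammer (e + lam) p / (pochhammer g n * pochhammer e n) * (nu * den)"
    using lower_right by (simp add: B_eq nu_den poch_int_of_nat Suc)
  define M where "M = (\<lambda>k. pochhammer (- of_nat n) k * pochhammer d k / (pochhammer g k * pochhammer e k))"
  have "hypF ([- of_nat n, a, b, d] @ shift_params fs ms) ([c, g, e] @ fs) = (\<Sum>k\<le>n. M k * A k)"
    unfolding append_Cons hypF_terminating by (simp add: M_def A_def mult_ac)
  also have "\<dots> = (\<Sum>k\<le>n. \<Sum>j\<le>k. M k * (pochhammer (- lam) (k - j) / fact (k - j)) * C j)"
    unfolding A_conv sum_distrib_left by (simp only: mult.assoc)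
  \<comment> \<open>Collecting by \<open>j\<close> isolates the factor of \<open>C j\<close> as a
    weighted tail sum, to be evaluated by \<open>near_Saalschutz_tail\<close>.\<close>
  also have "\<dots> = (\<Sum>j\<le>n. \<Sum>i\<le>n-j. M (j + i) * (pochhammer (- lam) (j + i - j) / fact (j + i - j)) * C j)"
    by (rule sum_triangle_diagonal[symmetric])
  also have "\<dots> = (\<Sum>j\<le>n. C j * (\<Sum>i\<le>n-j. M (j + i) * (pochhammer (- lam) i / fact i)))"
    by (simp add: sum_distrib_left mult_ac)
  also have "\<dots> = (\<Sum>j\<le>n. B * (pochhammer (- of_nat n) j * pochhammer d j * C j * (pochhammer (nu + 1) j / pochhammer nu j) /
      (pochhammer (g + lam) j * pochhammer (e + lam) j)))"
  proof (rule sum.cong[OF refl])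
    fix j assume "j \<in> {..n}"
    then have j: "j \<le> Suc p" using Suc by simp
    \<comment> \<open>The quadratic terms in \<open>j\<close> cancel, leaving
      \<open>den * (nu + j)\<close>: \<open>den\<close> is the slope and \<open>- nu\<close> the
      root. The root becomes the parameter pair \<open>nu + 1\<close>, \<open>nu\<close> through
      \<open>(nu + 1)_j / (nu)_j = (nu + j) / nu\<close>.\<close>
    have "of_nat (Suc p - j) * (d + of_nat j) + (g + lam + of_nat j - 1) * (e + lam + of_nat j - 1) = nu * den + of_nat j * den"
      unfolding nu_den unfolding den_def Suc using j by (simp add: of_nat_diff algebra_simps)
    also have "\<dots> = nu * den * (pochhammer (nu + 1) j / pochhammer nu j)"
    proof -
      have "nu * (pochhammer (nu + 1) j / pochhammer nu j) = nu + of_nat j"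
        using nz(6)[of j] pochhammer_rec[of nu j] pochhammer_rec'[of nu j] by (simp add: divide_simps)
      then show ?thesis by (metis distrib_right mult.assoc mult.commute)
    qed
    finally have lin: "of_nat (Suc p - j) * (d + of_nat j) + (g + lam + of_nat j - 1) * (e + lam + of_nat j - 1) =
      nu * den * (pochhammer (nu + 1) j / pochhammer nu j)" .
    show "C j * (\<Sum>i\<le>n-j. M (j + i) * (pochhammer (- lam) i / fact i)) =
      B * (pochhammer (- of_nat n) j * pochhammer d j * C j * (pochhammer (nu + 1) j / pochhammer nu j) /
      (pochhammer (g + lam) j * pochhammer (e + lam) j))"
      unfolding M_def B Suc
        near_Saalschutz_tail[OF balance[unfolded Suc] j nz(2) nz(3) nz(4) nz(5)] lin
      by (simp add: mult_ac)
  qed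
  also have "\<dots> = B * hypF ([- of_nat n, a + lam, b + lam, d, nu + 1] @ map (\<lambda>z. z + 1) zs)
                  ([c, g + lam, e + lam, nu] @ zs)"
    unfolding append_Cons hypF_terminating sum_distrib_left C_def zs_ratio[symmetric]
    by (simp add: comp_def mult_ac)
  finally show ?thesis .
qed

end
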